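(* Let $\mathbb P$ be a separative complete ortholattice, let $q\in\mathbb P$ and let $(p_\alpha)$ be a family of central elements of $\mathbb P$. Then 1. $q\wedge\bigvee_\alpha p_\alpha=\bigvee_\alpha(q\wedge p_\alpha)$, and 2. $q=\bigl(q\wedge\bigvee_\alpha p_\alpha\bigr)\vee\bigl(q\wedge(\bigvee_\alpha p_\alpha)^\perp\bigr)$.
   Context: An ortholattice is a lattice with least element $\mathbf 0$ and greatest element $\mathbf 1$ together with an orthocomplementation $p\mapsto p^\perp$, i.e. an antitone involution with $p\vee p^\perp=\mathbf 1$ and $p\wedge p^\perp=\mathbf 0$. It is complete if all subsets have suprema and infima. $\mathbb P$ is separative if for all $p,q\in\mathbb P$ with $p\nleq q$ there is $r\in\mathbb P$ with $\mathbf 0<r\le p$ and $r\wedge q=\mathbf 0$. Elements $s,t\in\mathbb P$ commute if both distributive laws $p\wedge(q\vee r)=(p\wedge q)\vee(p\wedge r)$ and $p\vee(q\wedge r)=(p\vee q)\wedge(p\vee r)$ hold for all $p,q,r\in\{s,s^\perp,t,t^\perp\}$. An element is central if it commutes with every element of $\mathbb P$. *)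

theory Defs
  imports "HOL-Library.Complemented_Lattices"
begin

unbundle lattice_syntax

class separative_lattice = bounded_lattice_bot +
  assumes separative: "\<not> p \<le> q \<Longrightarrow> \<exists>r. \<bottom> < r \<and> r \<le> p \<and> r \<sqinter> q = \<bottom>"

context orthocomplemented_lattice
begin

definition commuting :: "'a \<Rightarrow> 'a \<Rightarrow> bool" where
  "commuting s t \<longleftrightarrow>
    (\<forall>p\<in>{s, - s, t, - t}. \<forall>q\<in>{s, - s, t, - t}. \<forall>r\<in>{s, - s, t, - t}.
      p \<sqinter> (q \<squnion> r) = (p \<sqinter> q) \<squnion> (p \<sqinter> r) \<and>
      p \<squnion> (q \<sqinter> r) = (p \<squnion> q) \<sqinter> (p \<squnion> r))"

definition central :: "'a \<Rightarrow> bool" where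
  "central s \<longleftrightarrow> (\<forall>t. commuting s t)"

end

end

theory Submission
  imports Defs
begin

text \<open>
  Separativity turns an inequality \<open>a \<le> b\<close> into a disjointness question: it suffices that the only
  \<open>r \<le> a\<close> disjoint from \<open>b\<close> is \<open>\<bottom>\<close> (\<open>separative_leI\<close>). In both parts of the theorem, such an \<open>r\<close>,
  taken for the nontrivial inequality, lies below \<open>q\<close> and is disjoint from each \<open>p \<alpha>\<close>. In a general
  ortholattice disjointness from \<open>p \<alpha>\<close> does not give \<open>r \<le> - p \<alpha>\<close>, but it does when \<open>p \<alpha>\<close> is central,
  because then \<open>p \<alpha>\<close> splits \<open>r\<close> into \<open>r \<sqinter> p \<alpha>\<close> and \<open>r \<sqinter> - p \<alpha>\<close>. By De Morgan \<open>r\<close> then lies below the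
  complement of the supremum (\<open>le_compl_SUP_central\<close>). In the first part \<open>r\<close> also lies below the
  supremum itself, and in the second it is disjoint from its complement; either way \<open>r = \<bottom>\<close>.
\<close>

lemma separative_leI:
  fixes a b :: "'a::separative_lattice"
  assumes "\<And>r. r \<le> a \<Longrightarrow> r \<sqinter> b = \<bottom> \<Longrightarrow> r = \<bottom>"
  shows "a \<le> b"
  using assms separative[of a b] by auto

lemma central_split:
  fixes s t :: "'a::orthocomplemented_lattice"
  assumes "central s"
  shows "t = (t \<sqinter> s) \<squnion> (t \<sqinter> - s)"
proof -
  have "t \<sqinter> (s \<squnion> - s) = (t \<sqinter> s) \<squnion> (t \<sqinter> - s)"
    using assms unfolding central_def commuting_def by blast
  then show ?thesis by simp
qed

lemma le_compl_central:
  fixes r s :: "'a::orthocomplemented_lattice"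
  assumes "central s" and "r \<sqinter> s = \<bottom>"
  shows "r \<le> - s"
proof -
  have "r = r \<sqinter> - s"
    using central_split[OF assms(1), of r] assms(2) by simp
  then show ?thesis by (metis inf.cobounded2)
qed

text \<open>
  Centrality bounds each \<open>p i\<close> by the single element \<open>- r\<close>, hence also their supremum; this is how
  information about the members reaches a supremum over which meets need not distribute.
\<close>

lemma le_compl_SUP_central:
  fixes r :: "'a::complete_orthocomplemented_lattice"
  assumes "\<And>i. i \<in> I \<Longrightarrow> central (p i)" and "\<And>i. i \<in> I \<Longrightarrow> r \<sqinter> p i = \<bottom>"
  shows "r \<le> - (\<Squnion>i\<in>I. p i)"
proof -
  have "p i \<le> - r" if "i \<in> I" for i
    using le_compl_central[OF assms(1,2)] that by (metis compl_le_swap1)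
  then have "(\<Squnion>i\<in>I. p i) \<le> - r" by (rule SUP_least)
  then show ?thesis by (rule compl_le_swap1)
qed

theorem theorem2p22:
  fixes q :: "'a::{complete_orthocomplemented_lattice, separative_lattice}"
    and p :: "'i \<Rightarrow> 'a"
    and I :: "'i set"
  assumes "\<And>\<alpha>. \<alpha> \<in> I \<Longrightarrow> central (p \<alpha>)"
  shows "q \<sqinter> (\<Squnion>\<alpha>\<in>I. p \<alpha>) = (\<Squnion>\<alpha>\<in>I. q \<sqinter> p \<alpha>) \<and>
    q = (q \<sqinter> (\<Squnion>\<alpha>\<in>I. p \<alpha>)) \<squnion> (q \<sqinter> - (\<Squnion>\<alpha>\<in>I. p \<alpha>))"
proof (intro conjI antisym)
  let ?P = "\<Squnion>\<alpha>\<in>I. p \<alpha>" and ?S = "\<Squnion>\<alpha>\<in>I. q \<sqinter> p \<alpha>"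
  show "q \<sqinter> ?P \<le> ?S"
  proof (rule separative_leI)
    fix r assume r: "r \<le> q \<sqinter> ?P" "r \<sqinter> ?S = \<bottom>"
    have "r \<sqinter> p \<alpha> = \<bottom>" if "\<alpha> \<in> I" for \<alpha>
    proof -
      have "r \<sqinter> p \<alpha> \<le> q \<sqinter> p \<alpha>" using r(1) by (simp add: le_infI1)
      also have "\<dots> \<le> ?S" using that by (rule SUP_upper)
      finally have "r \<sqinter> p \<alpha> \<le> r \<sqinter> ?S" by simp
      then show ?thesis by (simp add: r(2) bot_unique)
    qed
    then have "r \<le> - ?P" using assms by (intro le_compl_SUP_central)
    moreover have "r \<le> ?P" using r(1) by (rule le_infE)
    ultimately have "r \<le> ?P \<sqinter> - ?P" by (intro le_infI)
    then have "r \<le> \<bottom>" by (simp only: inf_compl_bot)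
    then show "r = \<bottom>" by (simp only: bot_unique)
  qed
  show "?S \<le> q \<sqinter> ?P"
    by (intro SUP_least inf_mono order_refl SUP_upper)
next
  let ?P = "\<Squnion>\<alpha>\<in>I. p \<alpha>"
  let ?R = "(q \<sqinter> ?P) \<squnion> (q \<sqinter> - ?P)"
  show "q \<le> ?R"
  proof (rule separative_leI)
    fix r assume r: "r \<le> q" "r \<sqinter> ?R = \<bottom>"
    have disj: "r \<sqinter> x = \<bottom>" if "q \<sqinter> x \<le> ?R" for x
    proof -
      have "r \<sqinter> x \<le> q \<sqinter> x" using r(1) by (simp add: le_infI1)
      then have "r \<sqinter> x \<le> r \<sqinter> ?R" using that by (meson inf.boundedI inf.cobounded1 order_trans)
      then show ?thesis by (simp add: r(2) bot_unique)
    qed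
    have "r \<sqinter> p \<alpha> = \<bottom>" if "\<alpha> \<in> I" for \<alpha>
      using that by (intro disj le_supI1 inf_mono order_refl SUP_upper)
    then have "r \<le> - ?P" using assms by (intro le_compl_SUP_central)
    moreover have "r \<sqinter> - ?P = \<bottom>" by (rule disj) simp
    ultimately show "r = \<bottom>" by (simp add: inf.absorb1)
  qed
  show "?R \<le> q" by simp
qed

end
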